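(* Let $w\in\mathrm{Ops}^*$ with $[w]=1$, and let $w=w_1\cdots w_k$ be its context decomposition, where each context $w_i$ is irreducible. Then each $w_i$ has a factorization $w_i=w_{i,1}w_{i,2}\cdots w_{i,m_i}$ with $m_i\le k-1$ such that the sequence $w_{1,1},\ldots,w_{1,m_1},w_{2,1},\ldots,w_{2,m_2},\ldots,w_{k,1},\ldots,w_{k,m_k}$ is freely reducible.
   Context: Let $G=(V,I)$ be an undirected graph ($I$ symmetric, self-loops allowed but not required; $o_1\,I\,o_2$ means $(o_1,o_2)\in I$). $\mathrm{Ops}=\{o^+,o^-\mid o\in V\}$, $o^{\pm}$ denotes either; $o_1^{\pm}\,I\,o_2^{\pm}$ iff $o_1\,I\,o_2$, and for words $u,v$, $u\,I\,v$ means every operation of $u$ is independent of every operation of $v$. $\cong$ is the smallest congruence on $\mathrm{Ops}^*$ with $o_1^{\pm}o_2^{\pm}\cong o_2^{\pm}o_1^{\pm}$ for $o_1\,I\,o_2$ and $o^+o^-\cong\varepsilon$; $[w]$ is the class of $w$ in $\mathrm{Ops}^*/\!\cong$, $1=[\varepsilon]$. A set of symbols is dependent if it has no two distinct independent elements; a word is dependent if the set of symbols of its operations is. Context decomposition of $w\in\mathrm{Ops}^+$: if $w$ is dependent it is a single context; otherwise the first context is the maximal dependent prefix of $w$, followed by the context decomposition of the rest. A word $w$ is irreducible if it cannot be written as $w=w'\,a\,w_I\,b\,w''$ where either ($a=o^+$, $b=o^-$ and $o$ commutes with (is independent of) every symbol occurring in $w_I$) or ($a=o^-$, $b=o^+$,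 $o\,I\,o$, and $o$ commutes with every symbol occurring in $w_I$). A free reduction of a sequence $u_1,\ldots,u_n$ of words is a finite sequence of applications of the rules (FR1) replace two consecutive entries $u_i,u_j$ by nothing, applicable if $[u_iu_j]=1$; (FR2) replace consecutive entries $u_i,u_j$ by $u_j,u_i$, applicable if $u_i\,I\,u_j$; transforming the sequence into the empty sequence. The sequence is freely reducible if it admits a free reduction. *)

theory Defs
  imports Main
begin

text \<open>
  The graph is given by a vertex set \<open>V\<close> and its edge relation \<open>I\<close>, the independence relation;
  a self-loop is a pair \<open>(x, x) \<in> I\<close>. \<open>Pos x\<close> and \<open>Neg x\<close> are the operations written
  \<open>x\<^sup>+\<close> and \<open>x\<^sup>-\<close>, and words over the operations are lists.
\<close>

datatype 'v op = Pos (symb: 'v) | Neg (symb: 'v)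

definition Ops :: "'v set \<Rightarrow> 'v op set" where
  "Ops V = Pos ` V \<union> Neg ` V"

definition indep_words :: "('v \<times> 'v) set \<Rightarrow> 'v op list \<Rightarrow> 'v op list \<Rightarrow> bool" where
  "indep_words I u v \<longleftrightarrow> (\<forall>a \<in> set u. \<forall>b \<in> set v. (symb a, symb b) \<in> I)"

text \<open>
  In the rule \<open>comm\<close> the signs of the two operations are arbitrary, so a self-loop at \<open>x\<close> makes
  \<open>x\<^sup>+\<close> and \<open>x\<^sup>-\<close> commute.
\<close>

inductive_set op_cong :: "'v set \<Rightarrow> ('v \<times> 'v) set \<Rightarrow> ('v op list \<times> 'v op list) set"
  for V :: "'v set" and I :: "('v \<times> 'v) set" where
  refl: "w \<in> lists (Ops V) \<Longrightarrow> (w, w) \<in> op_cong V I"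
| sym: "(u, v) \<in> op_cong V I \<Longrightarrow> (v, u) \<in> op_cong V I"
| trans: "(u, v) \<in> op_cong V I \<Longrightarrow> (v, w) \<in> op_cong V I \<Longrightarrow> (u, w) \<in> op_cong V I"
| append: "(u, u') \<in> op_cong V I \<Longrightarrow> (v, v') \<in> op_cong V I \<Longrightarrow> (u @ v, u' @ v') \<in> op_cong V I"
| comm: "a \<in> Ops V \<Longrightarrow> b \<in> Ops V \<Longrightarrow> (symb a, symb b) \<in> I \<Longrightarrow> ([a, b], [b, a]) \<in> op_cong V I"
| cancel: "x \<in> V \<Longrightarrow> ([Pos x, Neg x], []) \<in> op_cong V I"

definition op_class :: "'v set \<Rightarrow> ('v \<times> 'v) set \<Rightarrow> 'v op list \<Rightarrow> 'v op list set" where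
  "op_class V I w = op_cong V I `` {w}"

definition dependent_set :: "('v \<times> 'v) set \<Rightarrow> 'v set \<Rightarrow> bool" where
  "dependent_set I S \<longleftrightarrow> (\<forall>x \<in> S. \<forall>y \<in> S. x \<noteq> y \<longrightarrow> (x, y) \<notin> I)"

definition dependent_word :: "('v \<times> 'v) set \<Rightarrow> 'v op list \<Rightarrow> bool" where
  "dependent_word I w \<longleftrightarrow> dependent_set I (symb ` set w)"

definition max_dependent_prefix :: "('v \<times> 'v) set \<Rightarrow> 'v op list \<Rightarrow> 'v op list" where
  "max_dependent_prefix I w = take (Max {n. n \<le> length w \<and> dependent_word I (take n w)}) w"

lemma max_dependent_prefix_nonempty:
  assumes "w \<noteq> []"
  shows "max_dependent_prefix I w \<noteq> []"
proof -
  let ?N = "{n. n \<le> length w \<and> dependent_word I (take n w)}"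
  from assms have "1 \<in> ?N"
    by (cases w) (auto simp: dependent_word_def dependent_set_def)
  moreover have "finite ?N"
    by simp
  ultimately have "1 \<le> Max ?N"
    by (rule Max_ge[rotated])
  with assms show ?thesis
    by (auto simp: max_dependent_prefix_def)
qed

text \<open>By convention the empty word has the empty context decomposition.\<close>

function context_decomp :: "('v \<times> 'v) set \<Rightarrow> 'v op list \<Rightarrow> 'v op list list" where
  "context_decomp I w =
    (if w = [] then []
     else if dependent_word I w then [w]
     else max_dependent_prefix I w #
       context_decomp I (drop (length (max_dependent_prefix I w)) w))"
  by auto
termination
  by (relation "measure (\<lambda>(I, w). length w)") (auto simp: max_dependent_prefix_nonempty)

declare context_decomp.simps [simp del]

definition irreducible_word :: "('v \<times> 'v) set \<Rightarrow> 'v op list \<Rightarrow> bool" where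
  "irreducible_word I w \<longleftrightarrow>
    \<not> (\<exists>w' a w\<^sub>I b w'' x.
          w = w' @ [a] @ w\<^sub>I @ [b] @ w'' \<and>
          (a = Pos x \<and> b = Neg x \<or> a = Neg x \<and> b = Pos x \<and> (x, x) \<in> I) \<and>
          (\<forall>c \<in> set w\<^sub>I. (x, symb c) \<in> I))"

inductive free_reduction_step ::
  "'v set \<Rightarrow> ('v \<times> 'v) set \<Rightarrow> 'v op list list \<Rightarrow> 'v op list list \<Rightarrow> bool"
  for V :: "'v set" and I :: "('v \<times> 'v) set" where
  FR1: "op_class V I (u @ v) = op_class V I [] \<Longrightarrow>
    free_reduction_step V I (us @ [u, v] @ vs) (us @ vs)"
| FR2: "indep_words I u v \<Longrightarrow>
    free_reduction_step V I (us @ [u, v] @ vs) (us @ [v, u] @ vs)"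

definition freely_reducible :: "'v set \<Rightarrow> ('v \<times> 'v) set \<Rightarrow> 'v op list list \<Rightarrow> bool" where
  "freely_reducible V I us \<longleftrightarrow> (free_reduction_step V I)\<^sup>*\<^sup>* us []"

end

theory Submission
  imports Defs
begin

text \<open>
  A self-loop at \<open>x\<close> makes \<open>x\<^sup>+\<close> and \<open>x\<^sup>-\<close> inverse to each other, so the congruence is already
  generated by commutations of operations on distinct symbols together with the cancellation of
  adjacent pairs \<open>x\<^sup>+x\<^sup>-\<close>, and \<open>x\<^sup>-x\<^sup>+\<close> for looped \<open>x\<close>. In this presentation two letters of one
  context never commute. Hence every elementary cancellation in an irreducible context sequence
  removes the last letter of a context \<open>i\<close> and the first letter of a later context \<open>j\<close>, while
  everything in the contexts between is independent of them.

  Consequently the part \<open>U i j\<close> of context \<open>i\<close> that cancels against context \<open>j\<close> is contiguous, and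
  these parts occur in the fixed order \<open>j = i - 1, \<dots>, 0, k - 1, \<dots>, i + 1\<close>; this gives \<open>k - 1\<close>
  (possibly empty) factors. Arcs \<open>{i, j}\<close> and \<open>{p, q}\<close> cross only if \<open>i < p < j < q\<close> (up to symmetry),
  and then their words are independent, so the factors can be removed by increasing \<open>j - i\<close>.
\<close>

section \<open>Words that cancel to the empty word\<close>

definition strictly_indep :: "('v \<times> 'v) set \<Rightarrow> 'v op \<Rightarrow> 'v op \<Rightarrow> bool" where
  "strictly_indep I a b \<longleftrightarrow> symb a \<noteq> symb b \<and> (symb a, symb b) \<in> I"

definition cancels :: "('v \<times> 'v) set \<Rightarrow> 'v op \<Rightarrow> 'v op \<Rightarrow> bool" where
  "cancels I a b \<longleftrightarrow> (\<exists>x. a = Pos x \<and> b = Neg x \<or> a = Neg x \<and> b = Pos x \<and> (x, x) \<in> I)"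

text \<open>Commutation is not a rule of its own but is built into the cancellation across
  \<open>m\<close>, so a derivation never reorders the letters that remain. This makes it possible
  to follow the contexts through a derivation.\<close>

inductive nullable :: "('v \<times> 'v) set \<Rightarrow> 'v op list \<Rightarrow> bool" for I where
  empty: "nullable I []"
| pair: "nullable I (u @ m @ v) \<Longrightarrow> cancels I a b \<Longrightarrow> \<forall>c \<in> set m. strictly_indep I a c \<Longrightarrow>
    nullable I (u @ a # m @ b # v)"

lemma strictly_indep_sym: "sym I \<Longrightarrow> strictly_indep I a b \<Longrightarrow> strictly_indep I b a"
  by (auto simp: strictly_indep_def dest: symD)

lemma cancels_symb: "cancels I a b \<Longrightarrow> symb b = symb a"
  by (auto simp: cancels_def)

lemma strictly_indep_cong: "symb a = symb b \<Longrightarrow> strictly_indep I a c = strictly_indep I b c"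
  by (auto simp: strictly_indep_def)

text \<open>Overlap analysis for the two lemmas below that modify an adjacent pair \<open>a\<close>,
  \<open>b\<close> of a word whose first cancellation removes \<open>c\<close> and
  \<open>d\<close>.\<close>

lemma adjacent_letters_cases:
  assumes "x @ a # b # y = u @ c # m @ d # v"
  obtains (left) u' where "u = x @ a # b # u'" "y = u' @ c # m @ d # v"
  | (left_edge) "u = x @ [a]" "b = c" "y = m @ d # v"
  | (start) m' where "u = x" "a = c" "m = b # m'" "y = m' @ d # v"
  | (both) "u = x" "a = c" "m = []" "b = d" "y = v"
  | (inside) m1 m2 where "x = u @ c # m1" "m = m1 @ a # b # m2" "y = m2 @ d # v"
  | (finish) m1 where "x = u @ c # m1" "m = m1 @ [a]" "b = d" "y = v"
  | (right_edge) "x = u @ c # m" "a = d" "v = b # y"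
  | (right) v1 where "x = u @ c # m @ d # v1" "v = v1 @ a # b # y"
proof -
  from assms consider
    (1) z where "u = x @ z" "a # b # y = z @ c # m @ d # v"
  | (2) z where "x = u @ z" "c # m @ d # v = z @ a # b # y"
    unfolding append_eq_append_conv2 by metis
  then show thesis
  proof cases
    case 1
    show thesis
    proof (cases z)
      case Nil
      with 1 show thesis by (cases m) (auto intro: start both)
    next
      case (Cons e z')
      with 1 show thesis by (cases z') (auto intro: left left_edge)
    qed
  next
    case 2
    show thesis
    proof (cases z)
      case Nil
      with 2 show thesis by (cases m) (auto intro: start both)
    next
      case (Cons e z')
      with 2 have z: "x = u @ c # z'" "m @ d # v = z' @ a # b # y" by auto
      then consider
        (3) t where "m = z' @ t" "t @ d # v = a # b # y"
      | (4) t where "z' = m @ t" "d # v = t @ a # b # y"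
        unfolding append_eq_append_conv2 by metis
      then show thesis
      proof cases
        case 3
        show thesis
        proof (cases t)
          case Nil
          with 3 z show thesis by (auto intro: right_edge)
        next
          case (Cons f t')
          with 3 z show thesis by (cases t') (auto intro: inside finish)
        qed
      next
        case 4
        with z show thesis by (cases t) (auto intro: right_edge right)
      qed
    qed
  qed
qed

text \<open>A swap that meets the first cancelled pair in one letter only moves the other letter
  into or out of the stretch between that pair. It cannot meet both letters, since cancelling
  letters share a symbol.\<close>

lemma nullable_swap:
  assumes "sym I"
  shows "nullable I w \<Longrightarrow> w = x @ a # b # y \<Longrightarrow> strictly_indep I a b \<Longrightarrow> nullable I (x @ b # a # y)"
proof (induction arbitrary: x y rule: nullable.induct)
  case empty
  then show ?case by simp
next
  case (pair u m v c d)
  note pairI = nullable.pair[OF _ \<open>cancels I c d\<close>]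
  have ba: "strictly_indep I b a" by (rule strictly_indep_sym[OF assms pair.prems(2)])
  have cd: "symb d = symb c" by (rule cancels_symb[OF pair.hyps(2)])
  from pair.prems(1)[symmetric] show ?case
  proof (cases rule: adjacent_letters_cases)
    case (left u')
    with pair.IH[of x "u' @ m @ v"] pair.prems(2) have "nullable I ((x @ b # a # u') @ m @ v)" by simp
    from pairI[OF this pair.hyps(3)] left show ?thesis by simp
  next
    case left_edge
    with pair.hyps ba pairI[of x "a # m" v] show ?thesis by simp
  next
    case (start m')
    with pair.hyps pairI[of "x @ [b]" "m'" v] show ?thesis by simp
  next
    case both
    with cd pair.prems(2) show ?thesis by (simp add: strictly_indep_def)
  next
    case (inside m1 m2)
    with pair.IH[of "u @ m1" "m2 @ v"] pair.prems(2) have "nullable I (u @ (m1 @ b # a # m2) @ v)" by simp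
    from pairI[OF this] inside pair.hyps(3) show ?thesis by simp
  next
    case (finish m1)
    with pair.hyps pairI[of u m1 "a # v"] show ?thesis by simp
  next
    case right_edge
    with pair.prems(2) cd have "strictly_indep I c b" by (simp add: strictly_indep_def)
    with right_edge pair.hyps pairI[of u "m @ [b]" y] show ?thesis by simp
  next
    case (right v1)
    with pair.IH[of "u @ m @ v1" y] pair.prems(2) have "nullable I (u @ m @ (v1 @ b # a # y))" by simp
    from pairI[OF this pair.hyps(3)] right show ?thesis by simp
  qed
qed

lemma nullable_move_right:
  assumes "sym I"
  shows "nullable I (u @ a # m @ v) \<Longrightarrow> \<forall>c \<in> set m. strictly_indep I a c \<Longrightarrow> nullable I (u @ m @ a # v)"
proof (induction m arbitrary: u)
  case (Cons c m)
  from nullable_swap[OF assms Cons.prems(1), of u a c "m @ v"] Cons.prems(2)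
  have "nullable I ((u @ [c]) @ a # m @ v)" by simp
  from Cons.IH[OF this] Cons.prems(2) show ?case by simp
qed simp

lemma nullable_move_left:
  assumes "sym I"
  shows "nullable I (u @ m @ a # v) \<Longrightarrow> \<forall>c \<in> set m. strictly_indep I a c \<Longrightarrow> nullable I (u @ a # m @ v)"
proof (induction m arbitrary: v rule: rev_induct)
  case (snoc c m)
  from snoc.prems have "strictly_indep I c a" using strictly_indep_sym[OF assms] by simp
  from nullable_swap[OF assms snoc.prems(1), of "u @ m" c a v] this
  have "nullable I (u @ m @ a # (c # v))" by simp
  from snoc.IH[OF this] snoc.prems(2) show ?case by simp
qed simp

text \<open>Confluence of the rewriting system, restricted to words rewriting to the empty word.\<close>

lemma nullable_cancel:
  assumes "sym I"
  shows "nullable I w \<Longrightarrow> w = x @ a # b # y \<Longrightarrow> cancels I a b \<Longrightarrow> nullable I (x @ y)"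
proof (induction arbitrary: x y rule: nullable.induct)
  case empty
  then show ?case by simp
next
  case (pair u m v c d)
  note pairI = nullable.pair[OF _ \<open>cancels I c d\<close>]
  have ba: "symb b = symb a" by (rule cancels_symb[OF pair.prems(2)])
  have cd: "symb d = symb c" by (rule cancels_symb[OF pair.hyps(2)])
  from pair.prems(1)[symmetric] show ?case
  proof (cases rule: adjacent_letters_cases)
    case (left u')
    with pair.IH[of x "u' @ m @ v"] pair.prems(2) have "nullable I ((x @ u') @ m @ v)" by simp
    from pairI[OF this pair.hyps(3)] left show ?thesis by simp
  next
    case left_edge
    \<comment> \<open>Both neighbours cancel against \<open>b\<close>, so they are equal. Deleting
      \<open>a\<close> and \<open>b\<close> leaves \<open>d\<close> behind \<open>m\<close>, while
      the derivation at hand has the same letter in front of \<open>m\<close>; moving it across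
      \<open>m\<close> closes the gap.\<close>
    with pair.prems(2) pair.hyps(2) have "a = d" by (auto simp: cancels_def)
    moreover have "\<forall>e \<in> set m. strictly_indep I a e"
      using pair.hyps(3) left_edge(2) ba strictly_indep_cong by blast
    ultimately show ?thesis
      using nullable_move_right[OF assms, of x a m v] pair.hyps(1) left_edge by simp
  next
    case (start m')
    with pair.hyps(3) ba show ?thesis by (simp add: strictly_indep_def)
  next
    case both
    with pair.hyps show ?thesis by simp
  next
    case (inside m1 m2)
    with pair.IH[of "u @ m1" "m2 @ v"] pair.prems(2) have "nullable I (u @ (m1 @ m2) @ v)" by simp
    from pairI[OF this] inside pair.hyps(3) show ?thesis by simp
  next
    case (finish m1)
    with pair.hyps(3) ba cd show ?thesis by (simp add: strictly_indep_def)
  next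
    case right_edge
    with pair.prems(2) pair.hyps(2) have "c = b" by (auto simp: cancels_def)
    with nullable_move_left[OF assms, of u m b y] pair.hyps(1,3) right_edge show ?thesis by simp
  next
    case (right v1)
    with pair.IH[of "u @ m @ v1" y] pair.prems(2) have "nullable I (u @ m @ (v1 @ y))" by simp
    from pairI[OF this pair.hyps(3)] right show ?thesis by simp
  qed
qed

section \<open>Nullable words and the congruence\<close>

lemma nullable_cancel_iff:
  assumes "sym I" "cancels I a b"
  shows "nullable I (x @ a # b # y) \<longleftrightarrow> nullable I (x @ y)"
  using nullable_cancel[OF assms(1) _ HOL.refl assms(2)] nullable.pair[of I x "[]" y a b] assms(2) by auto

lemma nullable_comm:
  assumes "sym I" "(symb a, symb b) \<in> I" "nullable I (x @ a # b # y)"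
  shows "nullable I (x @ b # a # y)"
proof (cases "symb a = symb b")
  case False
  with assms show ?thesis by (intro nullable_swap[OF assms(1,3) HOL.refl]) (simp add: strictly_indep_def)
next
  case True
  show ?thesis
  proof (cases "a = b")
    case True
    with assms show ?thesis by simp
  next
    case False
    \<comment> \<open>At a loop, opposite operations cancel in both orders, so swapping them amounts
      to deleting the pair and inserting it again.\<close>
    with True assms(2) have "cancels I a b" "cancels I b a"
      by (cases a; cases b; auto simp: cancels_def)+
    with assms show ?thesis by (simp add: nullable_cancel_iff)
  qed
qed

text \<open>This turns \<open>[w] = 1\<close> into a derivation of cancellations. The surrounding
  words \<open>x\<close> and \<open>y\<close> carry the induction through the rule
  \<open>append\<close>.\<close>

lemma op_cong_nullable_iff:
  assumes "sym I"
  shows "(u, v) \<in> op_cong V I \<Longrightarrow> nullable I (x @ u @ y) \<longleftrightarrow> nullable I (x @ v @ y)"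
proof (induction arbitrary: x y rule: op_cong.induct)
  case (append u u' v v')
  from append.IH(1)[of x "v @ y"] append.IH(2)[of "x @ u'" y] show ?case by simp
next
  case (comm a b)
  with assms have "(symb b, symb a) \<in> I" by (auto dest: symD)
  with comm nullable_comm[OF assms] show ?case by auto
next
  case (cancel z)
  have "cancels I (Pos z) (Neg z)" by (simp add: cancels_def)
  from nullable_cancel_iff[OF assms this] show ?case by simp
qed auto

lemma op_class_eq_iff:
  assumes "u \<in> lists (Ops V)" "v \<in> lists (Ops V)"
  shows "op_class V I u = op_class V I v \<longleftrightarrow> (u, v) \<in> op_cong V I"
  using assms unfolding op_class_def by (blast intro: op_cong.intros)

lemma op_cong_move_right:
  assumes "u \<in> lists (Ops V)" "v \<in> lists (Ops V)" "m \<in> lists (Ops V)" "a \<in> Ops V"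
    and "\<forall>c \<in> set m. strictly_indep I a c"
  shows "(u @ a # m @ v, u @ m @ a # v) \<in> op_cong V I"
  using assms(1,3,5)
proof (induction m arbitrary: u)
  case Nil
  with assms show ?case by (simp add: op_cong.refl)
next
  case (Cons c m)
  then have "([a, c], [c, a]) \<in> op_cong V I"
    using assms by (intro op_cong.comm) (auto simp: strictly_indep_def)
  from op_cong.append[OF op_cong.append[OF op_cong.refl[of u] this] op_cong.refl[of "m @ v"]] Cons assms
  have "(u @ a # c # m @ v, u @ c # a # m @ v) \<in> op_cong V I" by simp
  moreover from Cons.IH[of "u @ [c]"] Cons.prems have "(u @ c # a # m @ v, u @ c # m @ a # v) \<in> op_cong V I"
    by simp
  ultimately show ?case by (auto intro: op_cong.trans)
qed

lemma cancels_op_cong: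
  assumes "cancels I a b" "a \<in> Ops V"
  shows "([a, b], []) \<in> op_cong V I"
proof -
  from assms(1) obtain x where
    x: "a = Pos x \<and> b = Neg x \<or> a = Neg x \<and> b = Pos x \<and> (x, x) \<in> I"
    by (auto simp: cancels_def)
  with assms(2) have "x \<in> V" by (auto simp: Ops_def)
  from x show ?thesis
  proof
    assume "a = Pos x \<and> b = Neg x"
    with \<open>x \<in> V\<close> show ?thesis by (auto intro: op_cong.cancel)
  next
    assume *: "a = Neg x \<and> b = Pos x \<and> (x, x) \<in> I"
    with \<open>x \<in> V\<close> have "([Neg x, Pos x], [Pos x, Neg x]) \<in> op_cong V I"
      by (intro op_cong.comm) (auto simp: Ops_def)
    with * op_cong.cancel[OF \<open>x \<in> V\<close>] show ?thesis by (blast intro: op_cong.trans)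
  qed
qed

text \<open>The way back: it supplies the condition of (FR1) for the factors found by following a
  derivation.\<close>

lemma nullable_op_cong: "nullable I w \<Longrightarrow> w \<in> lists (Ops V) \<Longrightarrow> (w, []) \<in> op_cong V I"
proof (induction rule: nullable.induct)
  case empty
  then show ?case by (auto intro: op_cong.refl)
next
  case (pair u m v a b)
  then have *: "u \<in> lists (Ops V)" "m \<in> lists (Ops V)" "v \<in> lists (Ops V)" "a \<in> Ops V" "b \<in> Ops V"
    by auto
  have "(u @ a # m @ b # v, u @ m @ a # b # v) \<in> op_cong V I"
    using * pair.hyps by (intro op_cong_move_right) auto
  moreover have "(u @ m @ a # b # v, u @ m @ v) \<in> op_cong V I"
    using op_cong.append[OF op_cong.append[OF op_cong.refl[of "u @ m"] cancels_op_cong[OF pair.hyps(2)]] op_cong.refl[of v]] *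
    by simp
  moreover have "(u @ m @ v, []) \<in> op_cong V I" using pair.IH * by simp
  ultimately show ?case by (blast intro: op_cong.trans)
qed

section \<open>Contexts and what is left of them\<close>

lemma concat_context_decomp: "concat (context_decomp I w) = w"
proof (induction I w rule: context_decomp.induct)
  case (1 I w)
  then show ?case
    by (subst context_decomp.simps) (auto simp: max_dependent_prefix_def min_def)
qed

lemma dependent_max_dependent_prefix: "dependent_word I (max_dependent_prefix I w)"
proof -
  let ?N = "{n. n \<le> length w \<and> dependent_word I (take n w)}"
  have "0 \<in> ?N" by (simp add: dependent_word_def dependent_set_def)
  then have "Max ?N \<in> ?N" by (intro Max_in) auto
  then show ?thesis by (simp add: max_dependent_prefix_def)
qed

lemma dependent_context_decomp: "c \<in> set (context_decomp I w) \<Longrightarrow> dependent_word I c"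
proof (induction I w rule: context_decomp.induct)
  case (1 I w)
  show ?case
  proof (cases "w = [] \<or> dependent_word I w")
    case True
    with "1.prems" show ?thesis by (auto simp: context_decomp.simps[of I w] split: if_splits)
  next
    case False
    then have "context_decomp I w = max_dependent_prefix I w #
        context_decomp I (drop (length (max_dependent_prefix I w)) w)"
      by (simp add: context_decomp.simps[of I w])
    with "1.prems" "1.IH" False show ?thesis
      by (auto simp: dependent_max_dependent_prefix)
  qed
qed

text \<open>The remains of a context need not be a context of the remaining word. Hence only
  properties inherited by factors are kept: dependence and the absence of adjacent cancelling
  letters.\<close>

definition good_context :: "('v \<times> 'v) set \<Rightarrow> 'v op list \<Rightarrow> bool" where
  "good_context I w \<longleftrightarrow> dependent_word I w \<and> (\<nexists>u a b v. w = u @ a # b # v \<and> cancels I a b)"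

lemma good_context_sublist: "good_context I (u @ w @ v) \<Longrightarrow> good_context I w"
  unfolding good_context_def
proof (intro conjI)
  assume *: "dependent_word I (u @ w @ v) \<and> (\<nexists>p a b q. u @ w @ v = p @ a # b # q \<and> cancels I a b)"
  then show "dependent_word I w" by (simp add: dependent_word_def dependent_set_def)
  have "u @ (p @ a # b # q) @ v = (u @ p) @ a # b # (q @ v)" for p a b q by simp
  with * show "\<nexists>p a b q. w = p @ a # b # q \<and> cancels I a b" by blast
qed

lemma good_context_if_irreducible:
  assumes "dependent_word I w" "irreducible_word I w"
  shows "good_context I w"
proof -
  have False if "w = u @ a # b # v" "cancels I a b" for u a b v
  proof -
    from that(2) obtain x where
      "a = Pos x \<and> b = Neg x \<or> a = Neg x \<and> b = Pos x \<and> (x, x) \<in> I" by (auto simp: cancels_def)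
    moreover have "w = u @ [a] @ [] @ [b] @ v" using that(1) by simp
    ultimately show False using assms(2) unfolding irreducible_word_def by fastforce
  qed
  with assms(1) show ?thesis by (auto simp: good_context_def)
qed

lemma not_strictly_indep_in_context:
  "good_context I w \<Longrightarrow> a \<in> set w \<Longrightarrow> c \<in> set w \<Longrightarrow> \<not> strictly_indep I a c"
  by (auto simp: good_context_def dependent_word_def dependent_set_def strictly_indep_def)

section \<open>Locating a cancellation among the contexts\<close>

lemma concat_eq_append_ConsD:
  "concat ws = p @ a # q \<Longrightarrow>
    \<exists>us u v vs. ws = us @ (u @ a # v) # vs \<and> p = concat us @ u \<and> q = v @ concat vs"
proof (induction ws arbitrary: p)
  case (Cons w ws)
  then have "w @ concat ws = p @ a # q" by simp
  then consider z where "p = w @ z" "concat ws = z @ a # q"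
    | z where "w = p @ z" "z @ concat ws = a # q"
    unfolding append_eq_append_conv2 by metis
  then show ?case
  proof cases
    case 1
    from Cons.IH[OF 1(2)] obtain us u v vs where
      "ws = us @ (u @ a # v) # vs" "z = concat us @ u" "q = v @ concat vs" by blast
    with 1 have "w # ws = (w # us) @ (u @ a # v) # vs \<and> p = concat (w # us) @ u \<and> q = v @ concat vs"
      by simp
    then show ?thesis by blast
  next
    case 2
    show ?thesis
    proof (cases z)
      case Nil
      with 2 have "concat ws = [] @ a # q" by simp
      from Cons.IH[OF this] obtain us u v vs where
        "ws = us @ (u @ a # v) # vs" "[] = concat us @ u" "q = v @ concat vs" by blast
      with 2 Nil have "w # ws = (w # us) @ (u @ a # v) # vs \<and> p = concat (w # us) @ u \<and> q = v @ concat vs"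
        by simp
      then show ?thesis by blast
    next
      case (Cons e v)
      with 2 have "w # ws = [] @ (p @ a # v) # ws \<and> p = concat [] @ p \<and> q = v @ concat ws" by simp
      then show ?thesis by blast
    qed
  qed
qed simp

text \<open>The letters between a cancelling pair are strictly independent of it, so by dependence
  none of them shares a context with \<open>a\<close> or \<open>b\<close>. This forces
  \<open>a\<close> to the end of its context and \<open>b\<close> to the start of another.\<close>

lemma nullable_concat_cases:
  assumes "nullable I (concat ws)" and good: "\<forall>w \<in> set ws. good_context I w"
  obtains "concat ws = []"
  | us u a ms b v vs where "ws = us @ (u @ [a]) # ms @ (b # v) # vs" "cancels I a b"
      "\<forall>c \<in> set (concat ms). strictly_indep I a c" "nullable I (concat (us @ u # ms @ v # vs))"
  using assms(1)
proof (cases rule: nullable.cases)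
  case empty
  then show thesis using that(1) by simp
next
  case (pair p m q a b)
  from concat_eq_append_ConsD[OF pair(1)] obtain us u u' vs0 where
    1: "ws = us @ (u @ a # u') # vs0" "p = concat us @ u" "m @ b # q = u' @ concat vs0" by blast
  then have g1: "good_context I (u @ a # u')" using good by simp
  have empty1: "c \<notin> set m" if "c \<in> set u'" for c
    using that pair(4) not_strictly_indep_in_context[OF g1, of a c] by auto
  from 1(3) consider z where "u' = m @ z" "z @ concat vs0 = b # q"
    | z where "m = u' @ z" "concat vs0 = z @ b # q"
    unfolding append_eq_append_conv2 by metis
  \<comment> \<open>The letter \<open>b\<close> lies beyond the context of \<open>a\<close>: inside
    it nothing could stand between them, and they would be adjacent cancelling letters of a good
    context.\<close>
  then have "\<exists>z. m = u' @ z \<and> concat vs0 = z @ b # q"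
  proof cases
    case 1
    show ?thesis
    proof (cases z)
      case Nil
      with 1 show ?thesis by auto
    next
      case (Cons e z')
      have "m = []" using empty1 1(1) by (cases m) auto
      with 1 Cons g1 pair(3) show ?thesis by (auto simp: good_context_def)
    qed
  qed auto
  then obtain z where z: "m = u' @ z" "concat vs0 = z @ b # q" by blast
  with empty1 have "u' = []" by (cases u') auto
  from concat_eq_append_ConsD[OF z(2)] obtain ms v' v vs where
    2: "vs0 = ms @ (v' @ b # v) # vs" "z = concat ms @ v'" "q = v @ concat vs" by blast
  then have g2: "good_context I (v' @ b # v)" using good 1 by simp
  have "v' = []"
  proof (cases v')
    case (Cons c v'')
    then have "strictly_indep I b c"
      using pair(3,4) z(1) 2(2) cancels_symb[OF pair(3)] by (auto simp: strictly_indep_def)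
    with not_strictly_indep_in_context[OF g2, of b c] Cons show ?thesis by simp
  qed simp
  show thesis
    using 1 2 z \<open>u' = []\<close> \<open>v' = []\<close> pair by (intro that(2)[of us u a ms b v vs]) auto
qed

section \<open>The scheme of partial cancellations between contexts\<close>

text \<open>Bracket nesting: the start of a context cancels to the left and its end to the right,
  and in both directions the letters closest to the border go to the nearest partner.\<close>

definition partners :: "nat \<Rightarrow> nat \<Rightarrow> nat list" where
  "partners k i = rev [0..<i] @ rev [Suc i..<k]"

text \<open>\<open>U i j\<close> is the part of context \<open>i\<close> that cancels against
  context \<open>j\<close>. Equal symbol sets at the two ends of an arc transfer independence from
  one end to the other, so the last clause can speak of the left ends of crossing arcs
  alone.\<close>

definition cancellation_scheme ::
  "('v \<times> 'v) set \<Rightarrow> 'v op list list \<Rightarrow> (nat \<Rightarrow> nat \<Rightarrow> 'v op list) \<Rightarrow> bool" where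
  "cancellation_scheme I ws U \<longleftrightarrow>
    (\<forall>i < length ws. ws ! i = concat (map (U i) (partners (length ws) i))) \<and>
    (\<forall>i j. i < j \<longrightarrow> nullable I (U i j @ U j i)) \<and>
    (\<forall>i j. symb ` set (U i j) = symb ` set (U j i)) \<and>
    (\<forall>i p j q. i < p \<and> p < j \<and> j < q \<and> q < length ws \<longrightarrow> indep_words I (U i j) (U p q))"

lemma set_partners: "i < k \<Longrightarrow> set (partners k i) = {..<k} - {i}"
  by (auto simp: partners_def)

lemma length_partners: "i < k \<Longrightarrow> length (partners k i) = k - 1"
  by (simp add: partners_def)

lemma upt_split: "i \<le> j \<Longrightarrow> j \<le> k \<Longrightarrow> [i..<k] = [i..<j] @ [j..<k]"
  using upt_add_eq_append[of i j "k - j"] by simp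

lemma partners_split_right:
  assumes "i < j" "j < k"
  shows "partners k i = (rev [0..<i] @ rev [Suc j..<k]) @ j # rev [Suc i..<j]"
  using assms by (simp add: partners_def upt_split[of "Suc i" j k] upt_conv_Cons[of j k])

lemma partners_split_left:
  assumes "i < j"
  shows "partners k j = rev [Suc i..<j] @ i # (rev [0..<i] @ rev [Suc j..<k])"
  using assms by (simp add: partners_def upt_split[of 0 i j] upt_conv_Cons[of i j])

lemma indep_words_symb:
  "indep_words I u v \<longleftrightarrow> (\<forall>x \<in> symb ` set u. \<forall>y \<in> symb ` set v. (x, y) \<in> I)"
  by (auto simp: indep_words_def)

text \<open>Puts a cancelled pair back: \<open>a\<close> is appended to \<open>U i j\<close> and
  \<open>b\<close> is prepended to \<open>U j i\<close>. The order of the factors survives because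
  contexts \<open>i\<close> and \<open>j\<close> have only empty factors towards the contexts
  between them.\<close>

lemma cancellation_scheme_extend:
  fixes us ms vs :: "'v op list list"
  defines "i \<equiv> length us" and "j \<equiv> Suc (length us + length ms)"
  defines "k \<equiv> length us + length ms + length vs + 2"
  assumes "sym I"
    and U: "cancellation_scheme I (us @ u # ms @ v # vs) U"
    and good: "good_context I (u @ [a])" "good_context I (b # v)"
    and ab: "cancels I a b" and ms: "\<forall>c \<in> set (concat ms). strictly_indep I a c"
  shows "\<exists>U'. cancellation_scheme I (us @ (u @ [a]) # ms @ (b # v) # vs) U'"
proof -
  let ?ws = "us @ u # ms @ v # vs"
  define ws' where "ws' = us @ (u @ [a]) # ms @ (b # v) # vs"
  define U' where "U' = (\<lambda>p q. if p = i \<and> q = j then U i j @ [a] else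
    if p = j \<and> q = i then b # U j i else U p q)"
  have ij: "i < j" "j < k" by (simp_all add: i_def j_def k_def)
  have len: "length ?ws = k" "length ws' = k" by (simp_all add: k_def ws'_def)
  have nth: "?ws ! i = u" "?ws ! j = v" "ws' ! i = u @ [a]" "ws' ! j = b # v"
    by (simp_all add: i_def j_def ws'_def nth_append)
  have nth_other: "ws' ! l = ?ws ! l" if "l \<noteq> i" "l \<noteq> j" for l
    using that by (auto simp: i_def j_def ws'_def nth_append nth_Cons split: nat.splits)
  have nth_mid: "?ws ! l \<in> set ms" if "i < l" "l < j" for l
  proof -
    have "?ws ! l = ms ! (l - Suc i)" "l - Suc i < length ms"
      using that by (auto simp: i_def j_def nth_append nth_Cons' diff_Suc split: nat.splits)
    then show ?thesis by simp
  qed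
  have dec: "?ws ! l = concat (map (U l) (partners k l))" if "l < k" for l
    using U that len by (simp add: cancellation_scheme_def)
  have null: "nullable I (U p q @ U q p)" if "p < q" for p q
    using U that by (simp add: cancellation_scheme_def)
  have symb_eq: "symb ` set (U p q) = symb ` set (U q p)" for p q
    using U by (simp add: cancellation_scheme_def)
  have cross: "indep_words I (U p q) (U r s)" if "p < r" "r < q" "q < s" "s < k" for p q r s
    using U that len by (simp add: cancellation_scheme_def)
  have sub: "set (U p q) \<subseteq> set (?ws ! p)" if "p < k" "q < k" "p \<noteq> q" for p q
    using that by (auto simp: dec set_partners)
  have mid: "strictly_indep I a c" if "i < l" "l < j" "c \<in> set (U l q)" "q < k" "q \<noteq> l" for l q c
    using that ms nth_mid[of l] sub[of l q] ij by fastforce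
  \<comment> \<open>A factor cancelled against a context between \<open>i\<close> and
    \<open>j\<close> has the symbols of its counterpart there, so it is independent of
    \<open>a\<close> as well.\<close>
  have mid': "strictly_indep I a c" if c: "c \<in> set (U q l)" and l: "i < l" "l < j" "q < k" "q \<noteq> l" for l q c
  proof -
    from c have "symb c \<in> symb ` set (U l q)" using symb_eq[of q l] by blast
    then obtain d where "d \<in> set (U l q)" "symb c = symb d" by blast
    with mid[OF l(1,2) _ l(3,4)] show ?thesis by (simp add: strictly_indep_def)
  qed
  \<comment> \<open>Otherwise context \<open>i\<close> would contain a letter strictly independent
    of its own last letter \<open>a\<close>.\<close>
  have emp_i: "U i l = []" if "l \<in> {Suc i..<j}" for l
  proof (rule ccontr)
    assume "U i l \<noteq> []"
    then obtain c where c: "c \<in> set (U i l)" by (cases "U i l") auto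
    with mid'[OF c] sub[of i l] not_strictly_indep_in_context[OF good(1), of a c] that ij nth(1)
    show False by auto
  qed
  have emp_j: "U j l = []" if "l \<in> {Suc i..<j}" for l
  proof (rule ccontr)
    assume "U j l \<noteq> []"
    then obtain c where c: "c \<in> set (U j l)" by (cases "U j l") auto
    with mid'[OF c] that ij have "strictly_indep I a c" by auto
    then have "strictly_indep I b c" using cancels_symb[OF ab] by (simp add: strictly_indep_def)
    with c sub[of j l] not_strictly_indep_in_context[OF good(2), of b c] that ij nth(2)
    show False by auto
  qed
  have U'_other: "U' p q = U p q" if "\<not> (p = i \<and> q = j)" "\<not> (p = j \<and> q = i)" for p q
    using that by (auto simp: U'_def)
  have U'_ij: "U' i j = U i j @ [a]" and U'_ji: "U' j i = b # U j i"
    using ij by (auto simp: U'_def)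
  have dec': "ws' ! l = concat (map (U' l) (partners k l))" if "l < k" for l
  proof -
    consider "l = i" | "l = j" | "l \<noteq> i" "l \<noteq> j" by blast
    then show ?thesis
    proof cases
      case 1
      have "map (U' i) (rev [0..<i] @ rev [Suc j..<k]) = map (U i) (rev [0..<i] @ rev [Suc j..<k])"
        by (rule map_cong) (use ij in \<open>auto simp: U'_other\<close>)
      then have out: "concat (map (U' i) (rev [0..<i])) @ concat (map (U' i) (rev [Suc j..<k])) =
          concat (map (U i) (rev [0..<i])) @ concat (map (U i) (rev [Suc j..<k]))"
        unfolding map_append[symmetric] concat_append[symmetric] by (rule arg_cong)
      have mid: "concat (map (U' i) (rev [Suc i..<j])) = []" "concat (map (U i) (rev [Suc i..<j])) = []"
        using emp_i ij by (auto simp: U'_other)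
      \<comment> \<open>All partners listed after \<open>j\<close> contribute nothing, so a letter
        appended to \<open>U i j\<close> becomes the last letter of context
        \<open>i\<close>.\<close>
      have "concat (map (U' i) (partners k i)) = concat (map (U i) (partners k i)) @ [a]"
        unfolding partners_split_right[OF ij] map_append concat_append list.map concat.simps U'_ij
          mid out
        by simp
      with 1 dec[of i] ij nth show ?thesis by simp
    next
      case 2
      have "map (U' j) (rev [0..<i] @ rev [Suc j..<k]) = map (U j) (rev [0..<i] @ rev [Suc j..<k])"
        by (rule map_cong) (use ij in \<open>auto simp: U'_other\<close>)
      then have out: "concat (map (U' j) (rev [0..<i])) @ concat (map (U' j) (rev [Suc j..<k])) =
          concat (map (U j) (rev [0..<i])) @ concat (map (U j) (rev [Suc j..<k]))"
        unfolding map_append[symmetric] concat_append[symmetric] by (rule arg_cong)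
      have mid: "concat (map (U' j) (rev [Suc i..<j])) = []" "concat (map (U j) (rev [Suc i..<j])) = []"
        using emp_j ij by (auto simp: U'_other)
      have "concat (map (U' j) (partners k j)) = b # concat (map (U j) (partners k j))"
        unfolding partners_split_left[OF ij(1)] map_append concat_append list.map concat.simps U'_ji
          mid out
        by simp
      with 2 dec[of j] ij nth show ?thesis by simp
    next
      case 3
      then have "U' l = U l" by (auto simp: U'_other)
      with 3 nth_other dec that show ?thesis by simp
    qed
  qed
  have null': "nullable I (U' p q @ U' q p)" if "p < q" for p q
  proof (cases "p = i \<and> q = j")
    case True
    have "nullable I (U i j @ a # [] @ b # U j i)"
      by (rule nullable.pair) (use null[OF ij(1)] ab in simp_all)
    with True show ?thesis by (simp add: U'_ij U'_ji)
  next
    case False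
    with that ij have "U' p q = U p q" "U' q p = U q p" by (auto intro!: U'_other)
    with null[OF that] show ?thesis by simp
  qed
  have "symb ` set (U' i j) = symb ` set (U' j i)"
    using symb_eq[of i j] cancels_symb[OF ab] by (simp add: U'_ij U'_ji)
  then have symb_eq': "symb ` set (U' p q) = symb ` set (U' q p)" for p q
    using symb_eq[of p q] U'_other[of p q] U'_other[of q p] by metis
  have cross': "indep_words I (U' p q) (U' r s)" if *: "p < r" "r < q" "q < s" "s < k" for p q r s
  proof -
    \<comment> \<open>Only crossings with the arc from \<open>i\<close> to \<open>j\<close> involve
      a new letter, and the other arc then has an end strictly between \<open>i\<close> and
      \<open>j\<close>.\<close>
    consider "p = i" "q = j" | "r = i" "s = j" | "\<not> (p = i \<and> q = j)" "\<not> (r = i \<and> s = j)" by blast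
    then show ?thesis
    proof cases
      case 1
      with * have "i < r" "r < j" "s \<noteq> r" by auto
      with mid[of r _ s] \<open>s < k\<close> have "indep_words I [a] (U r s)"
        by (simp add: indep_words_def strictly_indep_def)
      moreover have "U' p q = U p q @ [a]" "U' r s = U r s"
        using 1 * U'_ij by (auto intro!: U'_other)
      ultimately show ?thesis using cross[OF *] by (auto simp: indep_words_def)
    next
      case 2
      with * ij have "i < q" "q < j" "p < k" "p \<noteq> q" by auto
      with mid'[of _ p q] \<open>sym I\<close> have "indep_words I (U p q) [a]"
        by (auto simp: indep_words_def strictly_indep_def dest: symD)
      moreover have "U' p q = U p q" "U' r s = U r s @ [a]"
        using 2 * U'_ij by (auto intro!: U'_other)
      ultimately show ?thesis using cross[OF *] by (auto simp: indep_words_def)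
    next
      case 3
      with * ij have "U' p q = U p q" "U' r s = U r s" by (auto intro!: U'_other)
      with cross[OF *] show ?thesis by simp
    qed
  qed
  have "cancellation_scheme I ws' U'"
    unfolding cancellation_scheme_def len
    by (intro conjI allI impI; (elim conjE)?) (fact dec' null' symb_eq' cross')+
  then show ?thesis unfolding ws'_def by blast
qed

text \<open>Induction on the number of letters left. Exhausted contexts stay in the list as empty
  words, so the indices of the contexts never change.\<close>

lemma cancellation_scheme_exists:
  assumes "sym I"
  shows "nullable I (concat ws) \<Longrightarrow> \<forall>w \<in> set ws. good_context I w \<Longrightarrow> \<exists>U. cancellation_scheme I ws U"
proof (induction "length (concat ws)" arbitrary: ws rule: less_induct)
  case less
  from less.prems show ?case
  proof (cases rule: nullable_concat_cases)
    case 1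
    have "ws ! l = concat (map (\<lambda>_. []) (partners (length ws) l))" if "l < length ws" for l
    proof -
      have "ws ! l = []" using 1 nth_mem[OF that] by (metis concat_eq_Nil_conv)
      then show ?thesis by simp
    qed
    then have "cancellation_scheme I ws (\<lambda>_ _. [])"
      by (simp add: cancellation_scheme_def indep_words_def nullable.empty)
    then show ?thesis by blast
  next
    case (2 us u a ms b v vs)
    let ?ws = "us @ u # ms @ v # vs"
    have "good_context I (u @ [a])" "good_context I (b # v)" using less.prems(2) 2(1) by auto
    moreover from this have "good_context I u" "good_context I v"
      using good_context_sublist[of I "[]" u "[a]"] good_context_sublist[of I "[b]" v "[]"] by auto
    then have "\<forall>w \<in> set ?ws. good_context I w" using less.prems(2) 2(1) by auto
    with less.hyps[of ?ws] 2 obtain U where "cancellation_scheme I ?ws U" by auto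
    ultimately show ?thesis
      using cancellation_scheme_extend[OF assms, of us u ms v vs U a b] 2 by blast
  qed
qed

section \<open>From the scheme to a free reduction\<close>

lemma free_reduction_move_right:
  "\<forall>y \<in> set ys. indep_words I u y \<Longrightarrow>
    (free_reduction_step V I)\<^sup>*\<^sup>* (xs @ u # ys @ zs) (xs @ ys @ u # zs)"
proof (induction ys arbitrary: xs)
  case (Cons y ys)
  have "free_reduction_step V I (xs @ u # y # ys @ zs) ((xs @ [y]) @ u # ys @ zs)"
    using free_reduction_step.FR2[of I u y V xs "ys @ zs"] Cons.prems by simp
  also have "(free_reduction_step V I)\<^sup>*\<^sup>* \<dots> ((xs @ [y]) @ ys @ u # zs)"
    using Cons.prems by (intro Cons.IH) simp
  finally show ?case by simp
qed simp

lemma freely_reducible_pair: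
  assumes "freely_reducible V I (xs @ ys @ zs)" "\<forall>y \<in> set ys. indep_words I u y"
    and "op_class V I (u @ v) = op_class V I []"
  shows "freely_reducible V I (xs @ u # ys @ v # zs)"
proof -
  have "(free_reduction_step V I)\<^sup>*\<^sup>* (xs @ u # ys @ v # zs) (xs @ ys @ u # v # zs)"
    by (rule free_reduction_move_right[OF assms(2)])
  also have "free_reduction_step V I (xs @ ys @ u # v # zs) (xs @ ys @ zs)"
    using free_reduction_step.FR1[OF assms(3), of "xs @ ys" zs] by simp
  also have "(free_reduction_step V I)\<^sup>*\<^sup>* (xs @ ys @ zs) []"
    using assms(1) by (simp add: freely_reducible_def)
  finally show ?thesis by (simp add: freely_reducible_def)
qed

text \<open>Induction on the set \<open>P\<close> of arcs still present, removing a shortest one.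
  Factors lying between its ends within contexts \<open>i\<close> and \<open>j\<close> would belong
  to shorter arcs, so only contexts strictly between separate \<open>U i j\<close> from
  \<open>U j i\<close>, and all their remaining arcs cross the chosen one.\<close>

lemma freely_reducible_arcs:
  fixes U :: "nat \<Rightarrow> nat \<Rightarrow> 'v op list"
  defines "arc \<equiv> \<lambda>P i j. (min i j, max i j) \<in> P"
  assumes "sym I"
    and one: "\<And>i j. i < j \<Longrightarrow> j < k \<Longrightarrow> op_class V I (U i j @ U j i) = op_class V I []"
    and symb_eq: "\<And>i j. symb ` set (U i j) = symb ` set (U j i)"
    and cross: "\<And>i p j q. i < p \<Longrightarrow> p < j \<Longrightarrow> j < q \<Longrightarrow> q < k \<Longrightarrow> indep_words I (U i j) (U p q)"
  shows "finite P \<Longrightarrow> P \<subseteq> {(i, j). i < j \<and> j < k} \<Longrightarrow>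
    freely_reducible V I (concat (map (\<lambda>i. map (U i) (filter (arc P i) (partners k i))) [0..<k]))"
proof (induction P rule: finite_psubset_induct)
  case (psubset P)
  show ?case
  proof (cases "P = {}")
    case True
    then have "concat (map (\<lambda>i. map (U i) (filter (arc P i) (partners k i))) [0..<k]) = []"
      by (simp add: arc_def)
    then show ?thesis unfolding freely_reducible_def by (simp only: rtranclp.rtrancl_refl)
  next
    case False
    then obtain i j where ij: "(i, j) \<in> P" and min: "\<And>p q. (p, q) \<in> P \<Longrightarrow> j - i \<le> q - p"
      using ex_has_least_nat[of "\<lambda>e. e \<in> P" _ "\<lambda>(p, q). q - p"] by fastforce
    with psubset.prems have lt: "i < j" "j < k" by auto
    \<comment> \<open>By minimality of \<open>j - i\<close>, no other arc of \<open>P\<close> has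
      both ends between \<open>i\<close> and \<open>j\<close> inclusive.\<close>
    have short: "\<not> arc P p q" if "i \<le> p" "p \<le> j" "i \<le> q" "q \<le> j" "{p, q} \<noteq> {i, j}" for p q
      using that min[of "min p q" "max p q"] psubset.prems lt by (auto simp: arc_def min_def max_def split: if_splits)
    define P' where "P' = P - {(i, j)}"
    have arc_P': "arc P' p q \<longleftrightarrow> arc P p q \<and> {p, q} \<noteq> {i, j}" for p q
      using lt by (auto simp: arc_def P'_def min_def max_def doubleton_eq_iff)
    have "arc P i j" "arc P j i" using ij lt by (auto simp: arc_def min_def max_def)
    define F where "F = (\<lambda>P i. map (U i) (filter (arc P i) (partners k i)))"
    \<comment> \<open>\<open>A\<close> will be what precedes \<open>U i j\<close> in context
      \<open>i\<close>, and \<open>B\<close> what follows \<open>U j i\<close> in context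
      \<open>j\<close>.\<close>
    define A where "A = map (U i) (filter (arc P i) (rev [0..<i] @ rev [Suc j..<k]))"
    define B where "B = map (U j) (filter (arc P j) (rev [0..<i] @ rev [Suc j..<k]))"
    have mid_i: "filter (arc P i) (rev [Suc i..<j]) = []" "filter (arc P' i) (rev [Suc i..<j]) = []"
      using short lt by (auto simp: arc_P' filter_empty_conv doubleton_eq_iff)
    have mid_j: "filter (arc P j) (rev [Suc i..<j]) = []" "filter (arc P' j) (rev [Suc i..<j]) = []"
      using short lt by (auto simp: arc_P' filter_empty_conv doubleton_eq_iff)
    have out_i: "filter (arc P' i) (rev [0..<i] @ rev [Suc j..<k]) = filter (arc P i) (rev [0..<i] @ rev [Suc j..<k])"
      by (rule filter_cong) (use lt in \<open>auto simp: arc_P' doubleton_eq_iff\<close>)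
    have out_j: "filter (arc P' j) (rev [0..<i] @ rev [Suc j..<k]) = filter (arc P j) (rev [0..<i] @ rev [Suc j..<k])"
      by (rule filter_cong) (use lt in \<open>auto simp: arc_P' doubleton_eq_iff\<close>)
    have Fi: "F P i = A @ [U i j]" "F P' i = A"
      using mid_i out_i \<open>arc P i j\<close>
      unfolding F_def A_def partners_split_right[OF lt] filter_append[of _ "rev [0..<i] @ rev [Suc j..<k]"] filter.simps
      by (simp_all add: arc_P')
    have Fj: "F P j = U j i # B" "F P' j = B"
      using mid_j out_j \<open>arc P j i\<close>
      unfolding F_def B_def partners_split_left[OF lt(1)] filter_append[of _ "rev [Suc i..<j]"] filter.simps
      by (simp_all add: arc_P' insert_commute)
    have F_other: "F P' l = F P l" if "l \<noteq> i" "l \<noteq> j" for l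
    proof -
      have "arc P' l = arc P l" by (rule ext) (use that in \<open>simp add: arc_P' doubleton_eq_iff\<close>)
      then show ?thesis by (simp add: F_def)
    qed
    define X where "X = concat (map (F P) [0..<i])"
    define M where "M = concat (map (F P) [Suc i..<j])"
    define Z where "Z = concat (map (F P) [Suc j..<k])"
    have split: "[0..<k] = [0..<i] @ i # [Suc i..<j] @ j # [Suc j..<k]"
      using lt by (simp add: upt_split[of 0 i k] upt_conv_Cons[of i k] upt_split[of "Suc i" j k] upt_conv_Cons[of j k])
    have P: "concat (map (F P) [0..<k]) = (X @ A) @ U i j # M @ U j i # (B @ Z)"
      by (simp add: split Fi Fj X_def M_def Z_def)
    have same: "map (F P') [0..<i] = map (F P) [0..<i]" "map (F P') [Suc i..<j] = map (F P) [Suc i..<j]"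
      "map (F P') [Suc j..<k] = map (F P) [Suc j..<k]"
      using lt by (auto intro!: F_other)
    have P': "concat (map (F P') [0..<k]) = (X @ A) @ M @ (B @ Z)"
      unfolding split map_append list.map concat_append concat.simps same
      by (simp add: Fi Fj X_def M_def Z_def)
    \<comment> \<open>An arc leaving a context between \<open>i\<close> and \<open>j\<close> cannot
      end within that range, so it crosses the arc being removed.\<close>
    have "indep_words I (U i j) y" if "y \<in> set M" for y
    proof -
      from that obtain l q where y: "y = U l q" and l: "i < l" "l < j" "q \<in> set (partners k l)" "arc P l q"
        by (auto simp: M_def F_def)
      then have "q < k" "q \<noteq> l" using lt by (auto simp: set_partners)
      have "q < i \<or> j < q" using short[of l q] l \<open>q \<noteq> l\<close> by (force simp: doubleton_eq_iff)
      then show ?thesis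
      proof
        assume "j < q"
        with l \<open>q < k\<close> y show ?thesis by (auto intro: cross)
      next
        assume "q < i"
        \<comment> \<open>Here the crossing clause speaks of the far end \<open>U q l\<close>;
          equality of the symbol sets carries the independence over to \<open>U l q\<close>.\<close>
        with l lt have "indep_words I (U q l) (U i j)" by (intro cross) auto
        with \<open>sym I\<close> symb_eq[of q l] y show ?thesis
          unfolding indep_words_symb by (blast dest: symD)
      qed
    qed
    moreover have "freely_reducible V I (concat (map (F P') [0..<k]))"
      unfolding F_def using psubset.prems ij by (intro psubset.IH) (auto simp: P'_def)
    ultimately have "freely_reducible V I (concat (map (F P) [0..<k]))"
      unfolding P P' using one[OF lt] by (blast intro: freely_reducible_pair)
    then show ?thesis by (simp add: F_def)
  qed
qed

section \<open>The factorization of the contexts\<close>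

theorem theorem6:
  fixes V :: "'v set" and I :: "('v \<times> 'v) set"
    and w :: "'v op list" and ws :: "'v op list list" and k :: nat
  assumes "I \<subseteq> V \<times> V" and "sym I"
    and "w \<in> lists (Ops V)"
    and "op_class V I w = op_class V I []"
    and "context_decomp I w = ws" and "length ws = k"
    and "\<forall>i<k. irreducible_word I (ws ! i)"
  shows "\<exists>fs :: 'v op list list list.
    length fs = k \<and>
    (\<forall>i<k. concat (fs ! i) = ws ! i \<and> length (fs ! i) \<le> k - 1) \<and>
    freely_reducible V I (concat fs)"
proof -
  have ws: "concat ws = w" using concat_context_decomp assms(5) by blast
  have "(w, []) \<in> op_cong V I" using assms(3,4) by (simp add: op_class_eq_iff)
  from op_cong_nullable_iff[OF assms(2) this, of "[]" "[]"] have "nullable I (concat ws)"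
    using ws by (simp add: nullable.empty)
  moreover have "\<forall>c \<in> set ws. good_context I c"
    using assms(5-7) dependent_context_decomp[of _ I w] good_context_if_irreducible
    by (metis in_set_conv_nth)
  ultimately obtain U where U: "cancellation_scheme I ws U"
    using cancellation_scheme_exists[OF assms(2)] by blast
  then have dec: "\<And>i. i < k \<Longrightarrow> ws ! i = concat (map (U i) (partners k i))"
    and null: "\<And>i j. i < j \<Longrightarrow> nullable I (U i j @ U j i)"
    and symb_eq: "\<And>i j. symb ` set (U i j) = symb ` set (U j i)"
    and cross: "\<And>i p j q. i < p \<Longrightarrow> p < j \<Longrightarrow> j < q \<Longrightarrow> q < k \<Longrightarrow> indep_words I (U i j) (U p q)"
    using assms(6) by (auto simp: cancellation_scheme_def)
  have letters: "U i j \<in> lists (Ops V)" if "i < k" "j < k" "i \<noteq> j" for i j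
  proof -
    have "set (U i j) \<subseteq> set (ws ! i)" using that by (auto simp: dec set_partners)
    also have "\<dots> \<subseteq> set w" using nth_mem[of i ws] that assms(6) ws by (metis Sup_upper image_eqI set_concat)
    finally show ?thesis using assms(3) by auto
  qed
  have one: "op_class V I (U i j @ U j i) = op_class V I []" if "i < j" "j < k" for i j
    using null[OF that(1)] letters[of i j] letters[of j i] that
    by (simp add: op_class_eq_iff nullable_op_cong)
  \<comment> \<open>Empty factors are kept: every context gets exactly \<open>k - 1\<close> factors,
    and a pair of empty ones is removed by (FR1) like any other.\<close>
  define fs where "fs = map (\<lambda>i. map (U i) (partners k i)) [0..<k]"
  \<comment> \<open>At the start all arcs are present, so filtering by \<open>?P\<close> keeps every
    partner.\<close>
  let ?P = "{(i, j). i < j \<and> j < k}"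
  have "finite ?P" by (rule finite_subset[of _ "{..<k} \<times> {..<k}"]) auto
  from freely_reducible_arcs[OF assms(2) one symb_eq cross this subset_refl]
  have "freely_reducible V I (concat (map (\<lambda>i. map (U i)
    (filter (\<lambda>j. (min i j, max i j) \<in> ?P) (partners k i))) [0..<k]))" .
  also have "map (\<lambda>i. map (U i) (filter (\<lambda>j. (min i j, max i j) \<in> ?P) (partners k i))) [0..<k] = fs"
    unfolding fs_def
  proof (rule map_cong[OF HOL.refl])
    fix i assume "i \<in> set [0..<k]"
    then have "filter (\<lambda>j. (min i j, max i j) \<in> ?P) (partners k i) = partners k i"
      by (auto simp: filter_id_conv set_partners)
    then show "map (U i) (filter (\<lambda>j. (min i j, max i j) \<in> ?P) (partners k i)) = map (U i) (partners k i)"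
      by simp
  qed
  finally have "freely_reducible V I (concat fs)" .
  moreover have "length fs = k" by (simp add: fs_def)
  moreover have "\<forall>i<k. concat (fs ! i) = ws ! i \<and> length (fs ! i) \<le> k - 1"
    by (simp add: fs_def dec length_partners)
  ultimately show ?thesis by blast
qed

end
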